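(* For all integers $r\geq 3$ and all $c>0$, $\varepsilon>0$ there exist $\xi=\xi(\varepsilon,c,r)>0$, $\beta=\beta(\varepsilon,c,r)>0$ and $n_0$ such that for every $n\geq n_0$ and every graph $G$ with $n$ vertices and $\lfloor cn^2\rfloor$ edges the following holds: if $k_r(G)<\xi n^r$, then there exists a partition $V(G)=V_1\cup V_2$ such that \[ e(V_1)<\varepsilon|V_1|^2\quad\text{and}\quad e(V_2)<(c-\beta)|V_2|^2. \]
   Context: All graphs are finite and simple. $k_r(G)$ is the number of $r$-cliques of $G$; $e(U)$ is the number of edges of the induced subgraph $G[U]$. *)

theory Defs
  imports Complex_Main "HOL-Library.Ramsey"
begin

definition simple_graph :: "'a set \<Rightarrow> 'a set set \<Rightarrow> bool" where
  "simple_graph V E \<longleftrightarrow> finite V \<and> E \<subseteq> [V]\<^bsup>2\<^esup>"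

definition num_cliques :: "nat \<Rightarrow> 'a set \<Rightarrow> 'a set set \<Rightarrow> nat" where
  "num_cliques r V E = card {K \<in> [V]\<^bsup>r\<^esup>. clique K E}"

definition num_edges_in :: "'a set set \<Rightarrow> 'a set \<Rightarrow> nat" where
  "num_edges_in E U = card {e \<in> E. e \<subseteq> U}"

end

theory Submission
  imports Defs "HOL-Library.Disjoint_Sets"
begin

text \<open>
  If \<open>W\<close> spans few \<open>(r+1)\<close>-cliques but many edges, some vertex of large degree lies in few of these
  cliques, so its neighbourhood spans few \<open>r\<close>-cliques; by induction on \<open>r\<close>, every graph with few
  \<open>r\<close>-cliques has a sparse vertex set of linear size. Removing such sets greedily and spreading the
  small remainder over them in proportion to their sizes partitions \<open>V\<close> into sparse sets of linear
  size. One of these sets, \<open>U\<close>, has average degree (in the whole graph) at least the overall average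
  \<open>2e(V)/n\<close>. Then \<open>e(V - U) = e(V) - (\<Sum>v\<in>U. deg v) + e(U)\<close> is at most about
  \<open>c(n - |U|)\<^sup>2 - c|U|\<^sup>2 + e(U)\<close>, and since \<open>U\<close> is sparse the last two terms contribute a negative
  multiple of \<open>n\<^sup>2\<close>.
\<close>

section \<open>Degree sums and edge counts\<close>

text \<open>The ambient set is a parameter because \<open>E\<close> stays fixed while vertex sets
  vary: in the induction on cliques \<open>W\<close> is an arbitrary vertex set, in the final degree
  argument it is all of \<open>V\<close>.\<close>

definition nbrs :: "'a set set \<Rightarrow> 'a set \<Rightarrow> 'a \<Rightarrow> 'a set" where
  "nbrs E W v = {u \<in> W. {v, u} \<in> E}"

lemma nbrs_subset: "nbrs E W v \<subseteq> W"
  by (auto simp: nbrs_def)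

lemma finite_edges_in: "finite W \<Longrightarrow> finite {e \<in> E. e \<subseteq> W}"
  by (rule finite_subset[of _ "Pow W"]) auto

lemma card_incident_edges:
  assumes E: "\<forall>e\<in>E. card e = 2" and "v \<in> W"
  shows "card {e \<in> E. e \<subseteq> W \<and> v \<in> e} = card (nbrs E W v)"
proof -
  have "{e \<in> E. e \<subseteq> W \<and> v \<in> e} = (\<lambda>u. {v, u}) ` nbrs E W v"
  proof (intro equalityI subsetI)
    fix e assume e: "e \<in> {e \<in> E. e \<subseteq> W \<and> v \<in> e}"
    then obtain a b where "e = {a, b}" using E by (auto simp: card_2_iff)
    then show "e \<in> (\<lambda>u. {v, u}) ` nbrs E W v"
      using e by (auto simp: nbrs_def insert_commute)
  qed (use assms(2) in \<open>auto simp: nbrs_def\<close>)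
  moreover have "inj_on (\<lambda>u. {v, u}) (nbrs E W v)"
    by (auto simp: inj_on_def doubleton_eq_iff)
  ultimately show ?thesis by (simp add: card_image)
qed

text \<open>Double counting of the incidences between vertices of \<open>U\<close> and edges inside
  \<open>W\<close>: an edge inside \<open>U\<close> is counted twice, an edge leaving
  \<open>U\<close> once.\<close>

lemma sum_card_nbrs:
  assumes E: "\<forall>e\<in>E. card e = 2" and "finite W" and "U \<subseteq> W"
  shows "(\<Sum>v\<in>U. card (nbrs E W v)) = (\<Sum>e | e \<in> E \<and> e \<subseteq> W. card (e \<inter> U))"
proof -
  have fU: "finite U" using assms finite_subset by blast
  have "(\<Sum>v\<in>U. card (nbrs E W v)) = (\<Sum>v\<in>U. \<Sum>e | e \<in> E \<and> e \<subseteq> W. of_bool (v \<in> e))"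
  proof (rule sum.cong)
    fix v assume "v \<in> U"
    then have "card (nbrs E W v) = card {e \<in> E. e \<subseteq> W \<and> v \<in> e}"
      using card_incident_edges[OF E, of v W] assms(3) by auto
    also have "\<dots> = (\<Sum>e | e \<in> E \<and> e \<subseteq> W. of_bool (v \<in> e))"
      using finite_edges_in[OF assms(2), of E]
      by (simp add: of_bool_def sum.If_cases Int_def conj_assoc)
    finally show "card (nbrs E W v) = (\<Sum>e | e \<in> E \<and> e \<subseteq> W. of_bool (v \<in> e))" .
  qed simp
  also have "\<dots> = (\<Sum>e | e \<in> E \<and> e \<subseteq> W. \<Sum>v\<in>U. of_bool (v \<in> e))"
    by (rule sum.swap)
  also have "\<dots> = (\<Sum>e | e \<in> E \<and> e \<subseteq> W. card (e \<inter> U))"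
    using fU by (intro sum.cong) (auto simp: of_bool_def sum.If_cases Int_def conj_commute)
  finally show ?thesis .
qed

lemma handshake:
  assumes E: "\<forall>e\<in>E. card e = 2" and "finite W"
  shows "(\<Sum>v\<in>W. card (nbrs E W v)) = 2 * num_edges_in E W"
proof -
  have "(\<Sum>e | e \<in> E \<and> e \<subseteq> W. card (e \<inter> W)) = (\<Sum>e | e \<in> E \<and> e \<subseteq> W. 2)"
    using E by (intro sum.cong) (auto simp: Int_absorb2)
  then show ?thesis
    by (simp add: sum_card_nbrs[OF E assms(2) order_refl] num_edges_in_def)
qed

text \<open>Compare what one edge inside \<open>W\<close> contributes to each side: if it has 0, 1
  or 2 ends in \<open>U\<close>, both sides receive 1, 1 or 2 respectively. The additive form avoids
  truncated subtraction.\<close>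

lemma num_edges_in_Diff:
  assumes E: "\<forall>e\<in>E. card e = 2" and "finite W" and "U \<subseteq> W"
  shows "num_edges_in E (W - U) + (\<Sum>v\<in>U. card (nbrs E W v)) = num_edges_in E W + num_edges_in E U"
proof -
  let ?F = "{e \<in> E. e \<subseteq> W}"
  have fin: "finite ?F" using finite_edges_in assms(2) .
  have 1: "num_edges_in E (W - U) = (\<Sum>e\<in>?F. of_bool (e \<inter> U = {}))"
  proof -
    have "{e \<in> E. e \<subseteq> W - U} = ?F \<inter> {e. e \<inter> U = {}}" by auto
    then show ?thesis using fin by (simp add: num_edges_in_def of_bool_def sum.If_cases)
  qed
  have 2: "num_edges_in E U = (\<Sum>e\<in>?F. of_bool (e \<subseteq> U))"
  proof -
    have "{e \<in> E. e \<subseteq> U} = ?F \<inter> {e. e \<subseteq> U}" using assms(3) by auto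
    then show ?thesis using fin by (simp add: num_edges_in_def of_bool_def sum.If_cases)
  qed
  have 3: "num_edges_in E W = (\<Sum>e\<in>?F. 1)" by (simp add: num_edges_in_def)
  have "of_bool (e \<inter> U = {}) + card (e \<inter> U) = 1 + of_bool (e \<subseteq> U)" if e: "e \<in> ?F" for e
  proof -
    obtain a b where "e = {a, b}" "a \<noteq> b" using e E by (metis (no_types, lifting) card_2_iff mem_Collect_eq)
    then show ?thesis by (cases "a \<in> U"; cases "b \<in> U") auto
  qed
  then show ?thesis
    by (simp only: 1 2 3 sum_card_nbrs[OF assms] sum.distrib[symmetric] cong: sum.cong)
qed

text \<open>Every edge that is not inside \<open>U\<close> has an end in \<open>X\<close>, and each
  vertex has degree at most \<open>card (U \<union> X)\<close>. This bounds the cost of adding a few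
  vertices to a sparse set.\<close>

lemma num_edges_in_Un_le:
  assumes E: "\<forall>e\<in>E. card e = 2" and "finite U" and "finite X"
  shows "num_edges_in E (U \<union> X) \<le> num_edges_in E U + card X * card (U \<union> X)"
proof -
  let ?I = "\<lambda>x. {e \<in> E. e \<subseteq> U \<union> X \<and> x \<in> e}"
  have fin: "finite (?I x)" for x
    by (rule finite_subset[OF _ finite_edges_in[of "U \<union> X" E]]) (use assms in auto)
  have "num_edges_in E (U \<union> X) \<le> card ({e \<in> E. e \<subseteq> U} \<union> (\<Union>x\<in>X. ?I x))"
    unfolding num_edges_in_def
    using assms fin finite_edges_in[of U E] by (intro card_mono) auto
  also have "\<dots> \<le> num_edges_in E U + card (\<Union>x\<in>X. ?I x)"
    unfolding num_edges_in_def by (rule card_Un_le)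
  also have "card (\<Union>x\<in>X. ?I x) \<le> (\<Sum>x\<in>X. card (?I x))"
    using assms by (intro card_UN_le)
  also have "\<dots> \<le> (\<Sum>x\<in>X. card (U \<union> X))"
  proof (rule sum_mono)
    fix x assume "x \<in> X"
    then have "card (?I x) = card (nbrs E (U \<union> X) x)"
      using card_incident_edges[OF E] by auto
    then show "card (?I x) \<le> card (U \<union> X)"
      using assms nbrs_subset by (metis card_mono finite_Un)
  qed
  finally show ?thesis by simp
qed

section \<open>Cliques inside neighbourhoods\<close>

lemma finite_nsets_cliques: "finite W \<Longrightarrow> finite {K \<in> [W]\<^bsup>r\<^esup>. clique K E}"
  by (rule finite_subset[of _ "Pow W"]) (auto simp: nsets_def)

lemma num_cliques_mono:
  assumes "finite W" and "U \<subseteq> W"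
  shows "num_cliques r U E \<le> num_cliques r W E"
  unfolding num_cliques_def
  using assms by (intro card_mono finite_nsets_cliques) (auto simp: nsets_def)

text \<open>Adding \<open>v\<close> to an r-clique of its neighbourhood gives, injectively, an
  (r+1)-clique through \<open>v\<close>, and each (r+1)-clique is obtained from at most one r-clique
  for each of its r+1 vertices.\<close>

lemma sum_num_cliques_nbrs:
  assumes E: "\<forall>e\<in>E. card e = 2" and W: "finite W"
  shows "(\<Sum>v\<in>W. num_cliques r (nbrs E W v) E) \<le> Suc r * num_cliques (Suc r) W E"
proof -
  let ?C = "{K \<in> [W]\<^bsup>Suc r\<^esup>. clique K E}"
  have fin: "finite ?C" using W by (rule finite_nsets_cliques)
  have "num_cliques r (nbrs E W v) E \<le> card {K \<in> ?C. v \<in> K}" if "v \<in> W" for v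
    unfolding num_cliques_def
  proof (rule card_inj_on_le[where f = "insert v"])
    \<comment> \<open>There are no loops, since \<open>{v, v}\<close> has one element. Hence
      \<open>insert v\<close> is injective here and raises the size by one.\<close>
    have v: "v \<notin> nbrs E W v" using E by (auto simp: nbrs_def)
    show "inj_on (insert v) {K \<in> [nbrs E W v]\<^bsup>r\<^esup>. clique K E}"
      using v by (auto simp: inj_on_def nsets_def dest!: insert_ident[THEN iffD1, rotated 2])
    show "insert v ` {K \<in> [nbrs E W v]\<^bsup>r\<^esup>. clique K E} \<subseteq> {K \<in> ?C. v \<in> K}"
    proof safe
      fix K assume K: "K \<in> [nbrs E W v]\<^bsup>r\<^esup>" "clique K E"
      then have "v \<notin> K" using v by (auto simp: nsets_def)
      then show "insert v K \<in> [W]\<^bsup>Suc r\<^esup>"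
        using K(1) that nbrs_subset[of E W v] by (auto simp: nsets_def)
      show "clique (insert v K) E"
        using K by (auto simp: clique_def nsets_def nbrs_def insert_commute)
    qed
    show "finite {K \<in> ?C. v \<in> K}" by (rule finite_subset[OF _ fin]) auto
  qed
  then have "(\<Sum>v\<in>W. num_cliques r (nbrs E W v) E) \<le> (\<Sum>v\<in>W. card {K \<in> ?C. v \<in> K})"
    by (rule sum_mono)
  also have "\<dots> = Suc r * card ?C"
  proof (rule sum_multicount[OF W fin], safe)
    fix K assume "K \<in> [W]\<^bsup>Suc r\<^esup>"
    then have "{v \<in> W. v \<in> K} = K" "card K = Suc r" by (auto simp: nsets_def)
    then show "card {v \<in> W. v \<in> K} = Suc r" by simp
  qed
  finally show ?thesis by (simp add: num_cliques_def)
qed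

section \<open>A sparse set of linear size\<close>

text \<open>With N = \<open>card W\<close>, the degrees sum to at least 2\<epsilon>N^2. Low-degree
  vertices account for at most \<epsilon>N^2 of this, so the others account for at least
  \<epsilon>N^2; as each has degree at most N, there are at least \<epsilon>N of them.\<close>

lemma many_high_degree_vertices:
  fixes \<epsilon> :: real
  assumes E: "\<forall>e\<in>E. card e = 2" and W: "finite W" and \<epsilon>: "\<epsilon> \<ge> 0"
    and dense: "\<epsilon> * real (card W) ^ 2 \<le> real (num_edges_in E W)"
  shows "\<epsilon> * real (card W) \<le> real (card {v \<in> W. \<epsilon> * real (card W) \<le> real (card (nbrs E W v))})"
proof (cases "card W = 0")
  case False
  let ?N = "real (card W)" and ?d = "\<lambda>v. real (card (nbrs E W v))"
  let ?H = "{v \<in> W. \<epsilon> * ?N \<le> ?d v}"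
  have "?d v \<le> \<epsilon> * ?N + ?N * of_bool (v \<in> ?H)" if "v \<in> W" for v
  proof (cases "v \<in> ?H")
    case True
    have "?d v \<le> ?N" using W nbrs_subset by (metis card_mono of_nat_mono)
    then show ?thesis using True \<epsilon> by (simp add: add_increasing)
  qed (use that in auto)
  then have "(\<Sum>v\<in>W. ?d v) \<le> (\<Sum>v\<in>W. \<epsilon> * ?N + ?N * of_bool (v \<in> ?H))"
    by (rule sum_mono)
  also have "\<dots> = ?N * (\<epsilon> * ?N) + ?N * (\<Sum>v\<in>W. of_bool (v \<in> ?H))"
    by (simp add: sum.distrib sum_distrib_left)
  also have "(\<Sum>v\<in>W. of_bool (v \<in> ?H)) = real (card ?H)"
    using W by (simp add: of_bool_def sum.If_cases Int_def)
  finally have "(\<Sum>v\<in>W. ?d v) \<le> ?N * (\<epsilon> * ?N) + ?N * real (card ?H)" .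
  moreover have "(\<Sum>v\<in>W. ?d v) = 2 * real (num_edges_in E W)"
    using handshake[OF E W] by (metis of_nat_mult of_nat_numeral of_nat_sum)
  ultimately have "?N * (\<epsilon> * ?N) \<le> ?N * real (card ?H)"
    using dense by (simp add: power2_eq_square algebra_simps)
  then show ?thesis using False by simp
qed simp

text \<open>Induction on \<open>r\<close> with \<epsilon> fixed. If \<open>W\<close> is not sparse
  itself, it has many vertices of large degree. Their neighbourhoods cannot all be rich in r-cliques
  without giving too many (r+1)-cliques, so the induction hypothesis applies to one of them.\<close>

lemma sparse_subset:
  fixes \<epsilon> :: real
  assumes \<epsilon>: "\<epsilon> > 0"
  shows "\<exists>\<xi>>0. \<exists>\<alpha>>0. \<forall>(W :: 'a set) E. finite W \<longrightarrow> (\<forall>e\<in>E. card e = 2) \<longrightarrow>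
    real (num_cliques r W E) < \<xi> * real (card W) ^ r \<longrightarrow>
    (\<exists>S\<subseteq>W. \<alpha> * real (card W) \<le> real (card S) \<and> real (num_edges_in E S) < \<epsilon> * real (card S) ^ 2)"
proof (induction r)
  case 0
  have "num_cliques 0 W E = 1" for W :: "'a set" and E
  proof -
    have "{K \<in> [W]\<^bsup>0\<^esup>. clique K E} = {{}}" by (auto simp: nsets_def clique_def)
    then show ?thesis by (simp add: num_cliques_def)
  qed
  \<comment> \<open>The empty set is the only 0-clique, so with \<xi> = 1 the hypothesis reads 1 < 1
    and no graph satisfies it.\<close>
  then show ?case by (intro exI[of _ 1] conjI) auto
next
  case (Suc r)
  then obtain \<xi> \<alpha> where \<xi>: "\<xi> > 0" and \<alpha>: "\<alpha> > 0"
    and IH: "\<And>(W :: 'a set) E. finite W \<Longrightarrow> \<forall>e\<in>E. card e = 2 \<Longrightarrow>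
      real (num_cliques r W E) < \<xi> * real (card W) ^ r \<Longrightarrow>
      \<exists>S\<subseteq>W. \<alpha> * real (card W) \<le> real (card S) \<and> real (num_edges_in E S) < \<epsilon> * real (card S) ^ 2"
    by metis
  \<comment> \<open>Chosen to make the averaging exact: if \<epsilon>N vertices each had
    \<xi>(\<epsilon>N)^r r-cliques in their neighbourhoods, there would be at least \<xi>'N^(r+1)
    cliques of size r+1.\<close>
  define \<xi>' where "\<xi>' = \<xi> * \<epsilon> ^ Suc r / Suc r"
  \<comment> \<open>The bound 1 serves the case where \<open>W\<close> itself is sparse. Otherwise
    the set is an \<alpha>-fraction of a neighbourhood with at least \<epsilon>N vertices.\<close>
  define \<alpha>' where "\<alpha>' = min 1 (\<alpha> * \<epsilon>)"
  have "\<exists>S\<subseteq>W. \<alpha>' * real (card W) \<le> real (card S) \<and> real (num_edges_in E S) < \<epsilon> * real (card S) ^ 2"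
    if W: "finite W" and E: "\<forall>e\<in>E. card e = 2"
      and few: "real (num_cliques (Suc r) W E) < \<xi>' * real (card W) ^ Suc r" for W :: "'a set" and E
  proof (cases "real (num_edges_in E W) < \<epsilon> * real (card W) ^ 2")
    case True
    then show ?thesis
      by (intro exI[of _ W]) (auto simp: \<alpha>'_def intro: mult_left_le_one_le order_trans[OF mult_right_mono[of _ 1]])
  next
    case False
    let ?N = "real (card W)"
    define H where "H = {v \<in> W. \<epsilon> * ?N \<le> real (card (nbrs E W v))}"
    have H: "\<epsilon> * ?N \<le> real (card H)"
      unfolding H_def using many_high_degree_vertices[OF E W, of \<epsilon>] \<epsilon> False by simp
    have "\<exists>v\<in>H. real (num_cliques r (nbrs E W v) E) < \<xi> * (\<epsilon> * ?N) ^ r"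
    proof (rule ccontr)
      assume "\<not> ?thesis"
      then have *: "\<xi> * (\<epsilon> * ?N) ^ r \<le> real (num_cliques r (nbrs E W v) E)" if "v \<in> H" for v
        using that by force
      have "\<epsilon> * ?N * (\<xi> * (\<epsilon> * ?N) ^ r) \<le> real (card H) * (\<xi> * (\<epsilon> * ?N) ^ r)"
        using H \<xi> \<epsilon> by (intro mult_right_mono) auto
      also have "\<dots> \<le> (\<Sum>v\<in>H. real (num_cliques r (nbrs E W v) E))"
        using sum_mono[of H "\<lambda>_. \<xi> * (\<epsilon> * ?N) ^ r", OF *] by simp
      also have "\<dots> \<le> (\<Sum>v\<in>W. real (num_cliques r (nbrs E W v) E))"
        using W by (intro sum_mono2) (auto simp: H_def)
      also have "\<dots> \<le> real (Suc r) * real (num_cliques (Suc r) W E)"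
        using sum_num_cliques_nbrs[OF E W, of r] by (metis of_nat_le_iff of_nat_mult of_nat_sum)
      also have "\<dots> < real (Suc r) * (\<xi>' * ?N ^ Suc r)"
        using few by (intro mult_strict_left_mono) auto
      also have "\<dots> = \<epsilon> * ?N * (\<xi> * (\<epsilon> * ?N) ^ r)"
        unfolding \<xi>'_def by (simp add: power_mult_distrib del: of_nat_Suc)
      finally show False by simp
    qed
    then obtain v where v: "v \<in> H" and "real (num_cliques r (nbrs E W v) E) < \<xi> * (\<epsilon> * ?N) ^ r" ..
    note this(2)
    also have "\<xi> * (\<epsilon> * ?N) ^ r \<le> \<xi> * real (card (nbrs E W v)) ^ r"
      using v \<xi> \<epsilon> by (intro mult_left_mono power_mono) (auto simp: H_def)
    finally obtain S where S: "S \<subseteq> nbrs E W v" "\<alpha> * real (card (nbrs E W v)) \<le> real (card S)"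
        "real (num_edges_in E S) < \<epsilon> * real (card S) ^ 2"
      using IH[OF finite_subset[OF nbrs_subset W] E] by blast
    have "\<alpha>' * ?N \<le> \<alpha> * (\<epsilon> * ?N)"
      unfolding \<alpha>'_def mult.assoc[symmetric] by (intro mult_right_mono) auto
    also have "\<dots> \<le> \<alpha> * real (card (nbrs E W v))"
      using v \<alpha> by (auto simp: H_def)
    finally show ?thesis using S nbrs_subset[of E W v] by (intro exI[of _ S]) auto
  qed
  moreover have "\<xi>' > 0" "\<alpha>' > 0" using \<xi> \<alpha> \<epsilon> by (auto simp: \<xi>'_def \<alpha>'_def)
  ultimately show ?case by blast
qed

section \<open>Partition into sparse sets of linear size\<close>

text \<open>Greedy removal, phrased through maximality: if a family with largest union left more
  than \<gamma>|V| vertices uncovered, these would still span few cliques relative to their number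
  and would contain one more sparse set.\<close>

lemma ex_disjoint_sparse_family:
  fixes \<epsilon> \<gamma> :: real
  assumes \<epsilon>: "\<epsilon> > 0" and \<gamma>: "\<gamma> > 0"
  shows "\<exists>\<xi>>0. \<exists>\<alpha>>0. \<forall>(V :: 'a set) E. finite V \<longrightarrow> (\<forall>e\<in>E. card e = 2) \<longrightarrow>
    real (num_cliques r V E) < \<xi> * real (card V) ^ r \<longrightarrow>
    (\<exists>P. \<Union>P \<subseteq> V \<and> disjoint P \<and> real (card (V - \<Union>P)) \<le> \<gamma> * real (card V) \<and>
      (\<forall>S\<in>P. \<alpha> * real (card V) \<le> real (card S) \<and> real (num_edges_in E S) < \<epsilon> * real (card S) ^ 2))"
proof -
  obtain \<xi> \<alpha> where \<xi>: "\<xi> > 0" and \<alpha>: "\<alpha> > 0"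
    and sparse: "\<And>(W :: 'a set) E. finite W \<Longrightarrow> \<forall>e\<in>E. card e = 2 \<Longrightarrow>
      real (num_cliques r W E) < \<xi> * real (card W) ^ r \<Longrightarrow>
      \<exists>S\<subseteq>W. \<alpha> * real (card W) \<le> real (card S) \<and> real (num_edges_in E S) < \<epsilon> * real (card S) ^ 2"
    using sparse_subset[OF \<epsilon>, of r] by metis
  have "\<exists>P. \<Union>P \<subseteq> V \<and> disjoint P \<and> real (card (V - \<Union>P)) \<le> \<gamma> * real (card V) \<and>
      (\<forall>S\<in>P. \<alpha> * \<gamma> * real (card V) \<le> real (card S) \<and> real (num_edges_in E S) < \<epsilon> * real (card S) ^ 2)"
    if V: "finite V" and E: "\<forall>e\<in>E. card e = 2"
      and few: "real (num_cliques r V E) < \<xi> * \<gamma> ^ r * real (card V) ^ r" for V :: "'a set" and E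
  proof -
    define good where "good P \<longleftrightarrow> \<Union>P \<subseteq> V \<and> disjoint P \<and>
      (\<forall>S\<in>P. \<alpha> * \<gamma> * real (card V) \<le> real (card S) \<and> real (num_edges_in E S) < \<epsilon> * real (card S) ^ 2)" for P
    have "good {}" by (simp add: good_def)
    moreover have "\<forall>P. good P \<longrightarrow> card (\<Union>P) < Suc (card V)"
      using V by (auto simp: good_def less_Suc_eq_le intro: card_mono)
    ultimately obtain P where P: "good P" and max: "\<And>Q. good Q \<Longrightarrow> card (\<Union>Q) \<le> card (\<Union>P)"
      using ex_has_greatest_nat[of good "{}" "\<lambda>P. card (\<Union>P)"] by (metis less_imp_le)
    let ?W = "V - \<Union>P"
    have "real (card ?W) \<le> \<gamma> * real (card V)"
    proof (rule ccontr)
      assume "\<not> ?thesis"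
      then have large: "\<gamma> * real (card V) \<le> real (card ?W)" by simp
      have "real (num_cliques r ?W E) \<le> real (num_cliques r V E)"
        using num_cliques_mono[OF V, of ?W r E] by simp
      also note few
      also have "\<xi> * \<gamma> ^ r * real (card V) ^ r = \<xi> * (\<gamma> * real (card V)) ^ r"
        by (simp add: power_mult_distrib)
      also have "\<dots> \<le> \<xi> * real (card ?W) ^ r"
        using large \<xi> \<gamma> by (intro mult_left_mono power_mono) auto
      finally obtain S where S: "S \<subseteq> ?W" "\<alpha> * real (card ?W) \<le> real (card S)"
          "real (num_edges_in E S) < \<epsilon> * real (card S) ^ 2"
        using sparse[OF _ E, of ?W] V by blast
      have "\<alpha> * \<gamma> * real (card V) \<le> \<alpha> * real (card ?W)"
        using large \<alpha> by (simp add: mult.assoc)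
      with S P have "good (insert S P)"
        unfolding good_def by (auto simp: disjoint_def pairwise_def disjnt_def)
      then have "card (\<Union>(insert S P)) \<le> card (\<Union>P)" by (rule max)
      \<comment> \<open>The strict edge bound fails for the empty set, so adding \<open>S\<close>
        strictly enlarges the union.\<close>
      moreover have "S \<noteq> {}" using S(3) by auto
      moreover have "finite S" "finite (\<Union>P)" "S \<inter> \<Union>P = {}"
        using S(1) P V by (auto simp: good_def intro: finite_subset)
      ultimately show False by (simp add: card_Un_disjoint)
    qed
    with P show ?thesis unfolding good_def by blast
  qed
  \<comment> \<open>The factors \<gamma>^r and \<gamma> pay for working in the uncovered set, which
    may be as small as \<gamma>|V|.\<close>
  then show ?thesis using \<xi> \<alpha> \<gamma>
    by (intro exI[of _ "\<xi> * \<gamma> ^ r"] exI[of _ "\<alpha> * \<gamma>"] conjI) auto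
qed

text \<open>Give \<open>p\<close> as many elements as its capacity \<open>f p\<close> allows; those
  left over fit into the remaining capacities. It serves to spread uncovered vertices over sparse
  sets.\<close>

lemma ex_assignment_bounded_fibres:
  fixes f :: "'b \<Rightarrow> nat"
  assumes "finite P" and "finite X" and "card X \<le> sum f P"
  shows "\<exists>h. h ` X \<subseteq> P \<and> (\<forall>p\<in>P. card {x \<in> X. h x = p} \<le> f p)"
  using assms
proof (induction P arbitrary: X rule: finite_induct)
  case (insert p P)
  obtain Y where Y: "Y \<subseteq> X" "card Y = min (f p) (card X)"
    using obtain_subset_with_card_n[of "min (f p) (card X)" X] by auto
  then have "card (X - Y) \<le> sum f P"
    using insert by (simp add: card_Diff_subset finite_subset)
  then obtain h where h: "h ` (X - Y) \<subseteq> P" "\<forall>p\<in>P. card {x \<in> X - Y. h x = p} \<le> f p"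
    using insert.IH[of "X - Y"] insert.prems by auto
  let ?h = "\<lambda>x. if x \<in> Y then p else h x"
  have "{x \<in> X. ?h x = p} = Y" using Y h(1) insert.hyps by auto
  moreover have "{x \<in> X. ?h x = q} = {x \<in> X - Y. h x = q}" if "q \<in> P" for q
    using that insert.hyps by auto
  ultimately show ?case using Y h by (intro exI[of _ ?h]) auto
qed auto

text \<open>Each set of the family absorbs at most an \<eta>-fraction of its own size from the
  uncovered vertices. Parts only grow, so \<alpha> is kept, and the added edges use up the second
  half of \<epsilon>.\<close>

lemma ex_sparse_partition:
  fixes \<epsilon> :: real
  assumes \<epsilon>: "\<epsilon> > 0"
  shows "\<exists>\<xi>>0. \<exists>\<alpha>>0. \<exists>n\<^sub>0. \<forall>(V :: 'a set) E. finite V \<longrightarrow> card V \<ge> n\<^sub>0 \<longrightarrow> (\<forall>e\<in>E. card e = 2) \<longrightarrow>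
    real (num_cliques r V E) < \<xi> * real (card V) ^ r \<longrightarrow>
    (\<exists>P. \<Union>P = V \<and> disjoint P \<and>
      (\<forall>U\<in>P. \<alpha> * real (card V) \<le> real (card U) \<and> real (num_edges_in E U) < \<epsilon> * real (card U) ^ 2))"
proof -
  \<comment> \<open>The bound \<epsilon>/2 limits the added edges; the bound 1 keeps the uncovered
    part below |V|/4, so the family covers at least half of \<open>V\<close>.\<close>
  define \<eta> where "\<eta> = min (\<epsilon> / 2) 1"
  have \<eta>: "\<eta> > 0" "\<eta> \<le> 1" "\<eta> \<le> \<epsilon> / 2" using \<epsilon> by (auto simp: \<eta>_def)
  obtain \<xi> \<alpha> where \<xi>: "\<xi> > 0" and \<alpha>: "\<alpha> > 0"
    and family: "\<And>(V :: 'a set) E. finite V \<Longrightarrow> \<forall>e\<in>E. card e = 2 \<Longrightarrow>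
      real (num_cliques r V E) < \<xi> * real (card V) ^ r \<Longrightarrow>
      \<exists>P. \<Union>P \<subseteq> V \<and> disjoint P \<and> real (card (V - \<Union>P)) \<le> \<eta> / 4 * real (card V) \<and>
        (\<forall>S\<in>P. \<alpha> * real (card V) \<le> real (card S) \<and> real (num_edges_in E S) < \<epsilon> / 2 * real (card S) ^ 2)"
    using ex_disjoint_sparse_family[of "\<epsilon> / 2" "\<eta> / 4" r] \<epsilon> \<eta> by (metis divide_pos_pos zero_less_numeral)
  \<comment> \<open>For such \<open>V\<close>, \<eta>|S| \<ge> 2 for each set \<open>S\<close> of
    the family, so rounding \<eta>|S| down loses at most half of it.\<close>
  define n\<^sub>0 where "n\<^sub>0 = nat \<lceil>2 / (\<eta> * \<alpha>)\<rceil>"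
  have "\<exists>P. \<Union>P = V \<and> disjoint P \<and>
      (\<forall>U\<in>P. \<alpha> * real (card V) \<le> real (card U) \<and> real (num_edges_in E U) < \<epsilon> * real (card U) ^ 2)"
    if V: "finite V" and n: "card V \<ge> n\<^sub>0" and E: "\<forall>e\<in>E. card e = 2"
      and few: "real (num_cliques r V E) < \<xi> * real (card V) ^ r" for V :: "'a set" and E
  proof -
    obtain P where P: "\<Union>P \<subseteq> V" "disjoint P" and rest: "real (card (V - \<Union>P)) \<le> \<eta> / 4 * real (card V)"
      and large: "\<And>S. S \<in> P \<Longrightarrow> \<alpha> * real (card V) \<le> real (card S)"
      and sparse: "\<And>S. S \<in> P \<Longrightarrow> real (num_edges_in E S) < \<epsilon> / 2 * real (card S) ^ 2"
      using family[OF V E few] by blast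
    define X where "X = V - \<Union>P"
    have finP: "finite P" using P V by (meson finite_UnionD finite_subset)
    have finS: "finite S" if "S \<in> P" for S using that P V by (meson Union_upper finite_subset)
    have X: "finite X" "X \<inter> \<Union>P = {}" using V by (auto simp: X_def)
    define f where "f S = nat \<lfloor>\<eta> * real (card S)\<rfloor>" for S :: "'a set"
    have f_le: "real (f S) \<le> \<eta> * real (card S)" for S
      using \<eta> by (simp add: f_def)
    have f_ge: "\<eta> / 2 * real (card S) \<le> real (f S)" if "S \<in> P" for S
    proof -
      have "2 / (\<eta> * \<alpha>) \<le> real (card V)" using n unfolding n\<^sub>0_def by linarith
      then have "2 \<le> \<eta> * (\<alpha> * real (card V))" using \<eta> \<alpha> by (simp add: field_simps)
      also have "\<dots> \<le> \<eta> * real (card S)" using large[OF that] \<eta> by simp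
      finally show ?thesis unfolding f_def by linarith
    qed
    \<comment> \<open>The total capacity is at least \<eta>/2 times the size of the union, hence at
      least \<eta>/4 |V|, which is exactly the bound on the uncovered part.\<close>
    have "real (card X) \<le> real (sum f P)"
    proof -
      have "card V = card (\<Union>P) + card X"
        using P V by (simp add: X_def card_Diff_subset finite_subset card_mono)
      moreover have "real (card X) \<le> 1 / 4 * real (card V)"
        using rest \<eta> unfolding X_def by (smt (verit) mult_right_mono of_nat_0_le_iff divide_right_mono)
      ultimately have "real (card V) \<le> 2 * real (card (\<Union>P))" by simp
      then have "\<eta> / 4 * real (card V) \<le> \<eta> / 2 * real (card (\<Union>P))"
        using mult_left_mono[of _ _ "\<eta> / 4"] \<eta> by fastforce
      also have "card (\<Union>P) = sum card P"
        using card_Union_disjoint[of P] P finS by (simp add: disjoint_def)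
      also have "\<eta> / 2 * real (sum card P) = (\<Sum>S\<in>P. \<eta> / 2 * real (card S))"
        by (simp add: sum_distrib_left)
      also have "\<dots> \<le> (\<Sum>S\<in>P. real (f S))" by (intro sum_mono f_ge)
      finally show ?thesis using rest by (simp add: X_def)
    qed
    then obtain h where h: "h ` X \<subseteq> P" and fibre: "\<And>S. S \<in> P \<Longrightarrow> card {x \<in> X. h x = S} \<le> f S"
      using ex_assignment_bounded_fibres[OF finP X(1), of f] by (metis of_nat_le_iff)
    define g where "g S = S \<union> {x \<in> X. h x = S}" for S
    have "\<Union>(g ` P) = \<Union>P \<union> X" using h by (auto simp: g_def)
    then have "\<Union>(g ` P) = V" using P by (auto simp: X_def)
    moreover have "disjoint (g ` P)"
    proof (rule disjointI)
      fix A B assume "A \<in> g ` P" "B \<in> g ` P" "A \<noteq> B"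
      then obtain S T where "S \<in> P" "T \<in> P" "S \<noteq> T" "A = g S" "B = g T" by auto
      moreover from this have "S \<inter> T = {}" using P by (auto dest: disjointD)
      ultimately show "A \<inter> B = {}" using X(2) by (auto simp: g_def)
    qed
    moreover have "\<alpha> * real (card V) \<le> real (card (g S)) \<and> real (num_edges_in E (g S)) < \<epsilon> * real (card (g S)) ^ 2"
      if S: "S \<in> P" for S
    proof
      let ?Y = "{x \<in> X. h x = S}" and ?s = "real (card S)" and ?t = "real (card (g S))"
      have st: "?s \<le> ?t" using finS[OF S] X(1) by (auto simp: g_def intro: card_mono)
      then show "\<alpha> * real (card V) \<le> ?t" using large[OF S] by simp
      have "num_edges_in E (g S) \<le> num_edges_in E S + card ?Y * card (g S)"
        unfolding g_def using num_edges_in_Un_le[OF E finS[OF S], of ?Y] X(1) by simp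
      then have "real (num_edges_in E (g S)) \<le> real (num_edges_in E S) + real (card ?Y) * ?t"
        by (metis of_nat_add of_nat_le_iff of_nat_mult)
      also have "\<dots> < \<epsilon> / 2 * ?s ^ 2 + \<epsilon> / 2 * ?t * ?t"
      proof (rule add_less_le_mono[OF sparse[OF S]])
        have "real (card ?Y) \<le> \<eta> * ?s" using fibre[OF S] f_le[of S] by linarith
        also have "\<dots> \<le> \<epsilon> / 2 * ?t" using \<eta> \<epsilon> st by (intro mult_mono) auto
        finally show "real (card ?Y) * ?t \<le> \<epsilon> / 2 * ?t * ?t" by (intro mult_right_mono) auto
      qed
      also have "\<dots> \<le> \<epsilon> / 2 * ?t ^ 2 + \<epsilon> / 2 * ?t * ?t"
        using st \<epsilon> by (intro add_right_mono mult_left_mono power_mono) auto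
      finally show "real (num_edges_in E (g S)) < \<epsilon> * ?t ^ 2" by (simp add: power2_eq_square)
    qed
    ultimately show ?thesis by (intro exI[of _ "g ` P"]) auto
  qed
  with \<xi> \<alpha> show ?thesis by blast
qed

section \<open>A part of large average degree\<close>

text \<open>Summed over the parts, both sides equal 2e(V), so the inequality cannot fail in every
  part.\<close>

lemma ex_part_of_large_average_degree:
  assumes E: "\<forall>e\<in>E. card e = 2" and V: "finite V" "V \<noteq> {}" and P: "\<Union>P = V" "disjoint P"
  shows "\<exists>U\<in>P. 2 * real (num_edges_in E V) / real (card V) * real (card U)
    \<le> real (\<Sum>v\<in>U. card (nbrs E V v))"
proof (rule ccontr)
  let ?a = "2 * real (num_edges_in E V) / real (card V)"
  assume "\<not> ?thesis"
  then have less: "real (\<Sum>v\<in>U. card (nbrs E V v)) < ?a * real (card U)" if "U \<in> P" for U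
    using that by force
  have finP: "finite P" using P V finite_UnionD by auto
  have finU: "\<forall>U\<in>P. finite U" using P V by (meson Union_upper finite_subset)
  have disj: "\<forall>A\<in>P. \<forall>B\<in>P. A \<noteq> B \<longrightarrow> A \<inter> B = {}" using P by (auto dest: disjointD)
  have "2 * real (num_edges_in E V) = real (\<Sum>v\<in>V. card (nbrs E V v))"
    using handshake[OF E V(1)] by simp
  also have "\<dots> = (\<Sum>U\<in>P. real (\<Sum>v\<in>U. card (nbrs E V v)))"
    using sum.Union_disjoint[OF finU disj, of "\<lambda>v. card (nbrs E V v)"] P(1) by simp
  \<comment> \<open>Strictness requires \<open>P\<close> to be nonempty, which follows from
    \<open>V \<noteq> {}\<close>.\<close>
  also have "\<dots> < (\<Sum>U\<in>P. ?a * real (card U))"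
    using finP less P V by (intro sum_strict_mono) auto
  also have "\<dots> = ?a * real (card V)"
    using card_Union_disjoint[of P] P finU by (simp add: sum_distrib_left disjoint_def)
  also have "\<dots> = 2 * real (num_edges_in E V)" using V by simp
  finally show False by simp
qed

section \<open>Counting the edges outside the chosen part\<close>

theorem theorem14:
  fixes r :: nat and c \<epsilon> :: real
  assumes "r \<ge> 3" and "c > 0" and "\<epsilon> > 0"
  shows "\<exists>\<xi>>0. \<exists>\<beta>>0. \<exists>n\<^sub>0::nat. \<forall>n\<ge>n\<^sub>0. \<forall>(V :: 'a set) E.
    simple_graph V E \<and> card V = n \<and> int (card E) = \<lfloor>c * real n ^ 2\<rfloor> \<longrightarrow>
    real (num_cliques r V E) < \<xi> * real n ^ r \<longrightarrow>
    (\<exists>V\<^sub>1 V\<^sub>2. V\<^sub>1 \<union> V\<^sub>2 = V \<and> V\<^sub>1 \<inter> V\<^sub>2 = {} \<and>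
      real (num_edges_in E V\<^sub>1) < \<epsilon> * real (card V\<^sub>1) ^ 2 \<and>
      real (num_edges_in E V\<^sub>2) < (c - \<beta>) * real (card V\<^sub>2) ^ 2)"
proof -
  \<comment> \<open>The bound \<epsilon> gives the condition on the first part; the bound c/2 leaves
    at least half of the gain c u^2 in the edge count outside \<open>U\<close>.\<close>
  define \<delta> where "\<delta> = min \<epsilon> (c / 2)"
  have \<delta>: "\<delta> > 0" "\<delta> \<le> \<epsilon>" "\<delta> \<le> c / 2" using assms by (auto simp: \<delta>_def)
  obtain \<xi> \<alpha> n\<^sub>1 where \<xi>: "\<xi> > 0" and \<alpha>: "\<alpha> > 0"
    and part: "\<And>(V :: 'a set) E. finite V \<Longrightarrow> card V \<ge> n\<^sub>1 \<Longrightarrow> \<forall>e\<in>E. card e = 2 \<Longrightarrow>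
      real (num_cliques r V E) < \<xi> * real (card V) ^ r \<Longrightarrow>
      \<exists>P. \<Union>P = V \<and> disjoint P \<and>
        (\<forall>U\<in>P. \<alpha> * real (card V) \<le> real (card U) \<and> real (num_edges_in E U) < \<delta> * real (card U) ^ 2)"
    using ex_sparse_partition[OF \<delta>(1), of r] by metis
  \<comment> \<open>As u \<ge> \<alpha>n, the remaining gain c/2 u^2 is at least 2\<beta>n^2. One
    \<beta>n^2 absorbs the rounding error 1, the other covers \<beta>(n - u)^2.\<close>
  define \<beta> where "\<beta> = c * \<alpha>\<^sup>2 / 4"
  have \<beta>: "\<beta> > 0" using assms \<alpha> by (simp add: \<beta>_def)
  \<comment> \<open>The summand 1 makes n > 1/\<beta> strict and n positive, whence \<beta>n^2 >
    1.\<close>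
  define n\<^sub>0 where "n\<^sub>0 = max n\<^sub>1 (nat \<lceil>1 / \<beta>\<rceil> + 1)"
  have "\<exists>V\<^sub>1 V\<^sub>2. V\<^sub>1 \<union> V\<^sub>2 = V \<and> V\<^sub>1 \<inter> V\<^sub>2 = {} \<and>
      real (num_edges_in E V\<^sub>1) < \<epsilon> * real (card V\<^sub>1) ^ 2 \<and>
      real (num_edges_in E V\<^sub>2) < (c - \<beta>) * real (card V\<^sub>2) ^ 2"
    if n: "n \<ge> n\<^sub>0" and G: "simple_graph V E" "card V = n" "int (card E) = \<lfloor>c * real n ^ 2\<rfloor>"
      and few: "real (num_cliques r V E) < \<xi> * real n ^ r" for n and V :: "'a set" and E
  proof -
    have V: "finite V" and E: "\<forall>e\<in>E. card e = 2" and EV: "{e \<in> E. e \<subseteq> V} = E"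
      using G(1) by (auto simp: simple_graph_def nsets_def)
    define m where "m = real (num_edges_in E V)"
    have "m = real (card E)" unfolding m_def num_edges_in_def EV ..
    then have m: "m \<le> c * real n ^ 2" "c * real n ^ 2 - 1 \<le> m"
      using G(3) by linarith+
    have n_pos: "real n > 0" and n_large: "1 / \<beta> < real n"
      using n unfolding n\<^sub>0_def by linarith+
    have "1 < \<beta> * real n" using n_large \<beta> by (simp add: field_simps)
    also have "\<dots> \<le> \<beta> * real n ^ 2" using \<beta> n_pos by (simp add: power2_eq_square)
    finally have n2: "1 < \<beta> * real n ^ 2" .
    obtain P where P: "\<Union>P = V" "disjoint P"
      and large: "\<And>U. U \<in> P \<Longrightarrow> \<alpha> * real n \<le> real (card U)"
      and sparse: "\<And>U. U \<in> P \<Longrightarrow> real (num_edges_in E U) < \<delta> * real (card U) ^ 2"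
      using part[OF V _ E] n few G(2) unfolding n\<^sub>0_def by auto
    have "V \<noteq> {}" using n_pos G(2) by auto
    then obtain U where U: "U \<in> P"
      and deg: "2 * m / real n * real (card U) \<le> real (\<Sum>v\<in>U. card (nbrs E V v))"
      using ex_part_of_large_average_degree[OF E V _ P] G(2) unfolding m_def by blast
    have UV: "U \<subseteq> V" using U P by auto
    define u where "u = real (card U)"
    have u: "0 \<le> u" "u \<le> real n" using card_mono[OF V UV] G(2) by (auto simp: u_def)
    have card_Diff: "real (card (V - U)) = real n - u"
      using card_Diff_subset[OF finite_subset[OF UV V] UV] card_mono[OF V UV] G(2) by (simp add: u_def of_nat_diff)
    have "real (num_edges_in E (V - U)) + real (\<Sum>v\<in>U. card (nbrs E V v)) = m + real (num_edges_in E U)"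
      using num_edges_in_Diff[OF E V UV] unfolding m_def by (metis of_nat_add)
    then have "real (num_edges_in E (V - U)) \<le> m * (1 - 2 * u / real n) + real (num_edges_in E U)"
      using deg by (simp add: u_def algebra_simps)
    also have "\<dots> < m * (1 - 2 * u / real n) + \<delta> * u ^ 2"
      using sparse[OF U] by (simp add: u_def)
    finally have "real (num_edges_in E (V - U)) < m * (1 - 2 * u / real n) + \<delta> * u ^ 2" .
    \<comment> \<open>The factor 1 - 2u/n may be negative, so m \<le> cn^2 alone does not suffice.
      Since m differs from cn^2 by at most 1 and the factor is at least -1, the replacement costs at
      most 1.\<close>
    moreover have "m * (1 - 2 * u / real n) \<le> c * real n ^ 2 * (1 - 2 * u / real n) + 1"
    proof -
      have "(c * real n ^ 2 - m) * (2 * u / real n - 1) \<le> (c * real n ^ 2 - m) * 1"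
        using m(1) u n_pos by (intro mult_left_mono) (auto simp: field_simps)
      then show ?thesis using m(2) by (simp add: algebra_simps)
    qed
    \<comment> \<open>Completing the square, n^2 - 2un = (n - u)^2 - u^2, isolates the gain c u^2
      that outweighs the \<delta>u^2 from the edges inside \<open>U\<close>.\<close>
    moreover have "c * real n ^ 2 * (1 - 2 * u / real n) = c * (real n - u) ^ 2 - c * u ^ 2"
      using n_pos by (simp add: field_simps power2_eq_square)
    ultimately have "real (num_edges_in E (V - U)) < c * (real n - u) ^ 2 - c * u ^ 2 + 1 + \<delta> * u ^ 2" by linarith
    moreover have "\<delta> * u ^ 2 \<le> c / 2 * u ^ 2" using \<delta> by (intro mult_right_mono) auto
    moreover have "2 * \<beta> * real n ^ 2 \<le> c / 2 * u ^ 2"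
    proof -
      have "(\<alpha> * real n) ^ 2 \<le> u ^ 2" using large[OF U] \<alpha> by (intro power_mono) (auto simp: u_def)
      then have "c / 2 * (\<alpha> * real n) ^ 2 \<le> c / 2 * u ^ 2" using assms by (intro mult_left_mono) auto
      then show ?thesis by (simp add: \<beta>_def power_mult_distrib)
    qed
    moreover have "\<beta> * (real n - u) ^ 2 \<le> \<beta> * real n ^ 2"
      using \<beta> u by (intro mult_left_mono power_mono) auto
    ultimately have "real (num_edges_in E (V - U)) < (c - \<beta>) * (real n - u) ^ 2"
      unfolding left_diff_distrib using n2 by linarith
    moreover have "real (num_edges_in E U) < \<epsilon> * u ^ 2"
      using sparse[OF U] mult_right_mono[OF \<delta>(2), of "u ^ 2"] by (simp add: u_def)
    ultimately show ?thesis
      using UV unfolding card_Diff[symmetric] u_def[symmetric]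
      by (intro exI[of _ U] exI[of _ "V - U"] conjI) (auto simp: u_def)
  qed
  with \<xi> \<beta> show ?thesis
    by (intro exI[of _ \<xi>] exI[of _ \<beta>] exI[of _ n\<^sub>0] conjI allI impI) auto
qed

end
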